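(* Let $A=\mathbb{F}_q[t]$, where $q$ is a power of an odd prime $p$, and let $d$ be a positive integer. The monic irreducible polynomials $\wp\in A$ of degree $d$ dividing the numerator of $1/[1]+1/[2]+\cdots+1/[d-1]\in\mathbb{F}_q(t)$ (equivalently, dividing the polynomial $-L_{d-1}'=L_{d-1}/[1]+\cdots+L_{d-1}/[d-1]$, where $'$ denotes $d/dt$) are exactly the Wilson primes of degree $d$, i.e. the monic irreducible $\wp$ of degree $d$ with $d^2\wp/dt^2=0$. Such primes exist only if $p$ divides $d$ or $d-1$. They divide $L_{d-1}'$ with multiplicity at least $p-2$.
   Context: For $n\ge 0$, $[n]:=t^{q^n}-t$. $L_0=1$ and $L_n=[n]L_{n-1}$ for $n\ge1$, so $L_{d-1}=[1][2]\cdots[d-1]$. A Wilson prime of degree $d$ is a monic irreducible $\wp$ of degree $d$ with $F_d\equiv-1\pmod{\wp^2}$, where $F_d$ is the product of all nonzero polynomials in $A$ of degree less than $d$; for $p>2$ this is equivalent to $d^2\wp/dt^2=0$. *)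

theory Defs
  imports
    "HOL-Computational_Algebra.Computational_Algebra"
    "HOL-Number_Theory.Cong"
    "HOL-Library.Cardinality"
    "HOL-Library.Extended_Nat"
begin

text \<open>
  The finite field with \<open>q\<close> elements is an arbitrary type \<open>'a :: {field, finite}\<close> with
  \<open>q = CARD('a)\<close>, the ring \<open>A\<close> is \<open>'a poly\<close>, and its fraction field is \<open>'a poly fract\<close>.
\<close>

definition bracket :: "nat \<Rightarrow> 'a :: {field, finite} poly" where
  "bracket n = monom 1 (CARD('a) ^ n) - monom 1 1"

primrec carlitz_L :: "nat \<Rightarrow> 'a :: {field, finite} poly" where
  "carlitz_L 0 = 1"
| "carlitz_L (Suc n) = bracket (Suc n) * carlitz_L n"

definition prod_nonzero_below :: "nat \<Rightarrow> 'a :: {field, finite} poly" where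
  "prod_nonzero_below d = (\<Prod>f | f \<noteq> 0 \<and> degree f < d. f)"

definition monic_irreducible :: "nat \<Rightarrow> 'a :: field poly \<Rightarrow> bool" where
  "monic_irreducible d P \<longleftrightarrow> lead_coeff P = 1 \<and> irreducible P \<and> degree P = d"

definition wilson_prime :: "nat \<Rightarrow> 'a :: {field, finite} poly \<Rightarrow> bool" where
  "wilson_prime d P \<longleftrightarrow>
     monic_irreducible d P \<and> [prod_nonzero_below d = - 1] (mod P\<^sup>2)"

text \<open>
  The numerator of a rational function in lowest terms, normalised by taking the denominator
  monic; the numerator of \<open>0\<close> is \<open>0\<close>. The library's \<open>quot_of_fract\<close> is not used since it would
  need the coefficients to be in \<open>field_gcd\<close>.
\<close>

definition lowest_terms :: "'a :: field poly fract \<Rightarrow> 'a poly \<Rightarrow> 'a poly \<Rightarrow> bool" where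
  "lowest_terms x a b \<longleftrightarrow> x = Fract a b \<and> lead_coeff b = 1 \<and> coprime a b"

definition numerator :: "'a :: field poly fract \<Rightarrow> 'a poly" where
  "numerator x = (THE a. \<exists>b. lowest_terms x a b)"

lemma lowest_terms_ex1:
  fixes x :: "'a :: field poly fract"
  shows "\<exists>!ab. lowest_terms x (fst ab) (snd ab)"
proof -
  define R where "R = (\<lambda>n. \<exists>a b. x = Fract a b \<and> b \<noteq> 0 \<and> degree b = n)"
  have "\<exists>n. R n"
    unfolding R_def by (cases x) auto
  then have "R (LEAST n. R n)"
    by (rule LeastI_ex)
  then obtain a b where ab: "x = Fract a b" "b \<noteq> 0" "degree b = (LEAST n. R n)"
    unfolding R_def by auto
  have minimal: "degree b \<le> degree b'" if "x = Fract a' b'" "b' \<noteq> 0" for a' b'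
    unfolding ab(3) using that by (intro Least_le) (auto simp: R_def)
  define u where "u = inverse (lead_coeff b)"
  have u: "u \<noteq> 0"
    using ab(2) by (simp add: u_def)
  define a0 b0 where "a0 = smult u a" and "b0 = smult u b"
  have x0: "x = Fract a0 b0" and b0: "b0 \<noteq> 0" "degree b0 = degree b" "lead_coeff b0 = 1"
    using ab u by (auto simp: a0_def b0_def eq_fract u_def)
  have multiple: "\<exists>c. a' = c * a0 \<and> b' = c * b0" if ab': "x = Fract a' b'" "b' \<noteq> 0" for a' b'
  proof -
    define c r where "c = b' div b0" and "r = b' mod b0"
    have b': "b' = c * b0 + r"
      by (simp add: c_def r_def)
    have cross: "a' * b0 = a0 * b'"
      using ab' x0 b0 by (simp add: eq_fract)
    have "r = 0"
    proof (rule ccontr)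
      assume "r \<noteq> 0"
      moreover have "(a' - c * a0) * b0 = a0 * r"
        using cross by (simp add: b' algebra_simps)
      ultimately have "x = Fract (a' - c * a0) r"
        using x0 b0 by (simp add: eq_fract)
      then have "degree b \<le> degree r"
        using \<open>r \<noteq> 0\<close> by (rule minimal)
      moreover have "degree r < degree b"
        using degree_mod_less[of b0 b'] b0 \<open>r \<noteq> 0\<close> by (simp add: r_def)
      ultimately show False by simp
    qed
    then have "a' * b0 = (c * a0) * b0"
      using cross by (simp add: b' algebra_simps)
    then have "a' = c * a0"
      using b0 by simp
    then show ?thesis
      using b' \<open>r = 0\<close> by auto
  qed
  have "coprime a0 b0"
  proof (rule coprimeI)
    fix c assume "c dvd a0" "c dvd b0"
    then obtain a' b' where c: "a0 = c * a'" "b0 = c * b'"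
      by (auto elim!: dvdE)
    have nz: "c \<noteq> 0" "b' \<noteq> 0"
      using c b0 by auto
    have "x = Fract a' b'"
      using x0 c nz by (simp add: eq_fract algebra_simps)
    then have "degree b0 \<le> degree b'"
      using minimal nz b0 by metis
    then have "degree c = 0"
      using c nz by (simp add: degree_mult_eq)
    then show "is_unit c"
      using nz by (simp add: is_unit_iff_degree)
  qed
  show ?thesis
  proof (rule ex1I[of _ "(a0, b0)"])
    show "lowest_terms x (fst (a0, b0)) (snd (a0, b0))"
      using x0 b0 \<open>coprime a0 b0\<close> by (simp add: lowest_terms_def)
  next
    fix p assume "lowest_terms x (fst p) (snd p)"
    then have p: "x = Fract (fst p) (snd p)" "lead_coeff (snd p) = 1" "coprime (fst p) (snd p)"
      by (auto simp: lowest_terms_def)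
    then have "snd p \<noteq> 0" by auto
    then obtain c where c: "fst p = c * a0" "snd p = c * b0"
      using multiple p(1) by blast
    then have "is_unit c"
      using p(3) by (metis coprime_common_divisor dvd_triv_left)
    moreover have "lead_coeff c = 1"
      using p(2) b0(3) unfolding c(2) lead_coeff_mult by simp
    ultimately have "c = 1"
      by (metis is_unit_iff_degree degree_0_id lead_coeff_1 degree_1 degree_eq_zeroE
          lead_coeff_pCons(2) one_pCons not_is_unit_0)
    then show "p = (a0, b0)"
      using c by (simp add: prod_eq_iff)
  qed
qed

text \<open>
  Multiplicity of \<open>P\<close> as a divisor, with value \<open>\<infinity>\<close> at \<open>0\<close>. (The library's \<open>multiplicity\<close>
  takes the value \<open>0\<close> there and, like \<open>quot_of_fract\<close>, needs further classes on the coefficients.)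
\<close>

definition prime_mult :: "'a :: field poly \<Rightarrow> 'a poly \<Rightarrow> enat" where
  "prime_mult P f = (SUP n \<in> {n. P ^ n dvd f}. enat n)"

end

(* For P irreducible of degree d, put c_i = t^(q^i). Every f in A satisfies f(c_i) = f(t)^(q^i), so
   the conjugates c_1, ..., c_d are zeros of P(X) modulo P(t)^q, with differences prime to P(t).
   Hence, as polynomials in X,
     (-1)^d P(X) = (c_d - X) H(X)  (mod P(t)^q),  where H(X) = (c_1 - X) ... (c_(d-1) - X).
   Here c_d - t = [d] is divisible by P exactly once, H(t) = L_(d-1) and, since the c_i have
   derivative 0, H'(t) = L_(d-1)'. Applying the (k+1)st X-derivative and setting X = t gives
     (-1)^d P^(k+1)(t) = [d] H^(k+1)(t) - (k+1) H^(k)(t)  (mod P^q).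
   For k = 1 this says that P divides L_(d-1)' iff P'' = 0; and if P'' = 0, descending from
   k = p - 2 to k = 1 gains a factor P at each step, so P^(p-2) divides H'(t).
   Carlitz's formula F_d L_d = (-1)^d D_d reads F_d L_(d-1) = -H(t + [d]), which is
   -L_(d-1) - [d] L_(d-1)' modulo P^2; this relates the Wilson congruence to L_(d-1)'. *)
theory Submission
  imports Defs
begin

subsection \<open>Polynomials over polynomial rings\<close>

text \<open>Zeros are counted modulo \<open>M\<close>: synthetic division splits off X - s, and
  since differences of points of \<open>S\<close> can be cancelled modulo \<open>M\<close>, the
  quotient again vanishes modulo \<open>M\<close> at the other points. Applied with \<open>M\<close>
  equal to P and to P^q.\<close>

lemma const_poly_dvd_of_many_zeros:
  fixes f :: "'b :: idom poly"
  assumes "finite S" and "degree f < card S"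
    and "\<And>x. x \<in> S \<Longrightarrow> M dvd poly f x"
    and "\<And>x y z. x \<in> S \<Longrightarrow> y \<in> S \<Longrightarrow> x \<noteq> y \<Longrightarrow> M dvd (x - y) * z \<Longrightarrow> M dvd z"
  shows "[:M:] dvd f"
  using assms
proof (induction S arbitrary: f rule: finite_induct)
  case (insert s S)
  define g where "g = synthetic_div f s"
  have f: "f = [:-s, 1:] * g + [:poly f s:]"
    unfolding g_def by (rule synthetic_div_correct'[symmetric])
  have "[:M:] dvd g"
  \<comment> \<open>A constant \<open>f\<close> is treated apart: \<open>degree f - 1\<close> is
    truncated there, and \<open>S\<close> may be empty.\<close>
  proof (cases "degree f = 0")
    case True
    then have "g = 0" by (simp add: g_def synthetic_div_eq_0_iff)
    then show ?thesis by simp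
  next
    case False
    show ?thesis
    proof (rule insert.IH)
      show "degree g < card S"
        using insert.prems(1) insert.hyps False by (simp add: g_def degree_synthetic_div)
    next
      fix y assume y: "y \<in> S"
      have "poly f y = (y - s) * poly g y + poly f s"
        by (subst f) (simp add: algebra_simps)
      moreover have "M dvd poly f y" "M dvd poly f s"
        using insert.prems(2) y by auto
      ultimately have "M dvd (y - s) * poly g y"
        by (simp add: dvd_add_left_iff)
      then show "M dvd poly g y"
        using insert.prems(3)[of y s] y insert.hyps(2) by auto
    next
      fix x y z assume "x \<in> S" "y \<in> S" "x \<noteq> y" "M dvd (x - y) * z"
      then show "M dvd z" using insert.prems(3)[of x y z] by auto
    qed
  qed
  then have "[:M:] dvd [:-s, 1:] * g" by (rule dvd_mult)
  moreover have "[:M:] dvd [:poly f s:]"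
    using insert.prems(2) by simp
  ultimately show ?case
    by (subst f) (rule dvd_add)
qed simp

text \<open>First-order Taylor expansion without denominators, to be used at X = t with h =
  [d].\<close>

lemma taylor_dvd:
  fixes f :: "'b :: idom poly"
  shows "h\<^sup>2 dvd poly f (x + h) - poly f x - h * poly (pderiv f) x"
proof (induction f)
  case (pCons a f)
  obtain k where "poly f (x + h) - poly f x - h * poly (pderiv f) x = h\<^sup>2 * k"
    using pCons.IH by (rule dvdE)
  then have k: "poly f (x + h) = poly f x + h * poly (pderiv f) x + h\<^sup>2 * k"
    by (simp only: diff_eq_eq ac_simps)
  have "poly (pCons a f) (x + h) - poly (pCons a f) x - h * poly (pderiv (pCons a f)) x
      = h\<^sup>2 * (poly (pderiv f) x + x * k + h * k)"
    unfolding poly_pCons pderiv_pCons poly_add k by (simp add: algebra_simps power2_eq_square)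
  then show ?case by simp
qed simp

text \<open>Constants of the outer variable X pass through X-derivatives, so all of \<open>M\<close>
  survives.\<close>

lemma const_poly_dvd_higher_pderiv:
  fixes f :: "'b :: idom poly"
  assumes "[:M:] dvd f"
  shows "M dvd poly ((pderiv ^^ k) f) x"
  using assms by (auto elim!: dvdE simp: higher_pderiv_smult)

text \<open>A linear factor has second derivative 0, so only two terms of Leibniz's rule
  remain.\<close>

lemma higher_pderiv_linear_mult:
  fixes f :: "'b :: idom poly"
  shows "(pderiv ^^ Suc k) ([:a, b:] * f)
    = [:a, b:] * (pderiv ^^ Suc k) f + smult (of_nat (Suc k) * b) ((pderiv ^^ k) f)"
proof (induction k)
  case 0
  show ?case by (simp add: pderiv_add pderiv_smult pderiv_pCons)
next
  case (Suc k)
  define g where "g = (pderiv ^^ k) f"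
  have "(pderiv ^^ Suc (Suc k)) ([:a, b:] * f)
      = pderiv ([:a, b:] * pderiv g + smult (of_nat (Suc k) * b) g)"
    using Suc by (simp add: g_def)
  also have "\<dots> = [:a, b:] * pderiv (pderiv g) + (smult b (pderiv g) + smult (of_nat (Suc k) * b) (pderiv g))"
    by (simp add: pderiv_add pderiv_smult pderiv_pCons algebra_simps del: of_nat_Suc)
  also have "\<dots> = [:a, b:] * pderiv (pderiv g) + smult (of_nat (Suc (Suc k)) * b) (pderiv g)"
    by (simp add: algebra_simps flip: smult_add_left)
  finally show ?case by (simp add: g_def)
qed

text \<open>This is P(X) in A[X] for P in A: X takes over the role of t. Evaluation at an element of
  A is then composition, and X-derivatives at X = t are t-derivatives.\<close>

definition lift_coeffs :: "'b :: comm_ring_1 poly \<Rightarrow> 'b poly poly" where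
  "lift_coeffs = map_poly (\<lambda>c. [:c:])"

lemma coeff_lift_coeffs [simp]: "coeff (lift_coeffs f) n = [:coeff f n:]"
  by (simp add: lift_coeffs_def coeff_map_poly)

lemma degree_lift_coeffs [simp]: "degree (lift_coeffs f) = degree f"
  by (simp add: lift_coeffs_def degree_map_poly)

lemma lift_coeffs_pCons: "lift_coeffs (pCons c f) = pCons [:c:] (lift_coeffs f)"
  by (rule poly_eqI) (simp add: coeff_pCons split: nat.split)

lemma lift_coeffs_0 [simp]: "lift_coeffs 0 = 0"
  by (rule poly_eqI) simp

lemma poly_lift_coeffs: "poly (lift_coeffs f) g = pcompose f g"
  by (induction f) (simp_all add: lift_coeffs_pCons pcompose_pCons)

lemma pderiv_lift_coeffs:
  fixes f :: "'b :: idom poly"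
  shows "pderiv (lift_coeffs f) = lift_coeffs (pderiv f)"
  by (rule poly_eqI) (simp add: coeff_pderiv of_nat_poly)

lemma higher_pderiv_lift_coeffs:
  fixes f :: "'b :: idom poly"
  shows "(pderiv ^^ k) (lift_coeffs f) = lift_coeffs ((pderiv ^^ k) f)"
  by (induction k) (simp_all add: pderiv_lift_coeffs)

section \<open>Cancellation of prime powers, and products over a finite field\<close>

lemma prime_elem_power_dvd_cancel:
  fixes P :: "'b :: algebraic_semidom"
  assumes "prime_elem P" "\<not> P dvd a" "P ^ k dvd a * b"
  shows "P ^ k dvd b"
  using prime_elem_power_dvd_cases[of P k a b 1 k] assms by auto

text \<open>
  The library states this only for the class \<open>finite_field\<close>, which the sort
  \<open>{field, finite}\<close> does not provide.
\<close>

lemma finite_field_power_card: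
  fixes x :: "'a :: {field, finite}"
  shows "x ^ CARD('a) = x"
proof (cases "x = 0")
  case False
  have "x * (\<Prod>y\<in>UNIV-{0}. x * y) = x * x ^ (CARD('a) - 1) * \<Prod>(UNIV-{0})"
    by (simp add: prod.distrib mult_ac)
  also have "x * x ^ (CARD('a) - 1) = x ^ Suc (CARD('a) - 1)"
    by (subst power_Suc) auto
  also have "Suc (CARD('a) - 1) = CARD('a)"
    using finite_UNIV_card_ge_0[where ?'a = 'a] by simp
  also have "(\<Prod>y\<in>UNIV-{0}. x * y) = (\<Prod>y\<in>UNIV-{0}. y)"
    by (rule prod.reindex_bij_witness[of _ "\<lambda>y. y / x" "\<lambda>y. x * y"]) (use False in auto)
  finally show ?thesis
    by simp
qed simp

lemma one_less_card_field: "1 < CARD('a :: {field, finite})"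
proof -
  have "card {0, 1 :: 'a} \<le> CARD('a)" by (rule card_mono) auto
  then show ?thesis by simp
qed

text \<open>As polynomials in x, both sides are monic of degree q with the zeros -c z, which are q
  in number for z \<noteq> 0; their difference has degree below q and so vanishes.\<close>

lemma prod_add_const_mult:
  fixes x z :: "'a :: {field, finite} poly"
  shows "(\<Prod>c\<in>UNIV. x + [:c:] * z) = x ^ CARD('a) - z ^ (CARD('a) - 1) * x"
proof (cases "z = 0")
  case True
  then show ?thesis using one_less_card_field[where ?'a = 'a] by (simp add: zero_power)
next
  case False
  define q where "q = CARD('a)"
  have q: "1 < q" unfolding q_def by (rule one_less_card_field)
  define F where "F = (\<Prod>c\<in>(UNIV :: 'a set). [:[:c:] * z, 1:])"
  define G where "G = monom (1 :: 'a poly) q - monom (z ^ (q - 1)) 1"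
  define S where "S = (\<lambda>c. - [:c:] * z) ` (UNIV :: 'a set)"
  have inj: "inj (\<lambda>c :: 'a. - [:c:] * z)"
  proof (rule injI)
    fix x y :: 'a assume "- [:x:] * z = - [:y:] * z"
    then have "smult (x - y) z = 0" by (simp add: smult_diff_left)
    with False show "x = y" by simp
  qed
  have cardS: "card S = q"
    unfolding S_def q_def by (rule card_image[OF inj])
  have degF: "degree F = q" and lcF: "coeff F q = 1"
  proof -
    show *: "degree F = q"
      unfolding F_def q_def by (subst degree_prod_eq_sum_degree) auto
    have "lead_coeff F = 1"
      unfolding F_def lead_coeff_prod by (rule prod.neutral) simp
    with * show "coeff F q = 1" by simp
  qed
  have "F - G = 0"
  proof (rule ccontr)
    assume "F - G \<noteq> 0"
    have "degree (F - G) < q"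
    proof (rule degree_lessI)
      show "F - G \<noteq> 0 \<or> q > 0" using q by simp
      show "\<forall>k\<ge>q. coeff (F - G) k = 0"
        using q degF lcF by (auto simp: G_def le_less intro!: coeff_eq_0)
    qed
    moreover have "S \<subseteq> {x. poly (F - G) x = 0}"
    proof
      fix y assume "y \<in> S"
      then obtain c where y: "y = - [:c:] * z" by (auto simp: S_def)
      have "poly F y = 0"
        unfolding F_def poly_prod by (rule prod_zero) (auto simp: y intro!: bexI[of _ c])
      moreover have "poly G y = 0"
      proof -
        have "([:- c:] :: 'a poly) ^ q = [:- c:]"
          unfolding poly_const_pow q_def finite_field_power_card ..
        then have "y ^ q = [:- c:] * z ^ q"
          unfolding y using power_mult_distrib[of "[:- c:]" z q]
          by (metis minus_pCons minus_zero)
        also have "z ^ q = z ^ (q - 1) * z"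
          using q by (simp flip: power_Suc2)
        finally show ?thesis
          by (simp add: G_def poly_monom y)
      qed
      ultimately show "y \<in> {x. poly (F - G) x = 0}" by simp
    qed
    then have "card S \<le> card {x. poly (F - G) x = 0}"
      using \<open>F - G \<noteq> 0\<close> by (intro card_mono poly_roots_finite)
    moreover have "card {x. poly (F - G) x = 0} \<le> degree (F - G)"
      using \<open>F - G \<noteq> 0\<close> by (rule card_poly_roots_bound)
    ultimately show False using cardS by simp
  qed
  then have "poly F x = poly G x" by simp
  then show ?thesis
    by (simp add: F_def G_def poly_prod poly_monom q_def add.commute)
qed

subsection \<open>Carlitz's products\<close>

text \<open>Carlitz's D_n, the product of all monic polynomials of degree n; this follows from
  \<open>prod_add_polys_below\<close> and \<open>carlitz_e_ind_power\<close>.\<close>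

primrec carlitz_D :: "nat \<Rightarrow> 'a :: {field, finite} poly" where
  "carlitz_D 0 = 1"
| "carlitz_D (Suc n) = bracket (Suc n) * carlitz_D n ^ CARD('a)"

text \<open>Carlitz's F_q-linear polynomial whose zeros are the polynomials of degree below n. The
  recursion, rather than the product over the zeros, makes additivity an easy induction.\<close>

primrec carlitz_e :: "nat \<Rightarrow> 'a :: {field, finite} poly \<Rightarrow> 'a poly" where
  "carlitz_e 0 x = x"
| "carlitz_e (Suc n) x =
     carlitz_e n x ^ CARD('a) - carlitz_D n ^ (CARD('a) - 1) * carlitz_e n x"

text \<open>Given by vanishing coefficients, this contains 0 for every n and is plainly closed under
  differences.\<close>

definition polys_below :: "nat \<Rightarrow> 'b :: zero poly set" where
  "polys_below n = {f. \<forall>i\<ge>n. coeff f i = 0}"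

abbreviation (input) ind :: "'b :: comm_semiring_1 poly" where
  "ind \<equiv> [:0, 1:]"

lemma bracket_eq: "(bracket n :: 'a :: {field, finite} poly) = ind ^ (CARD('a) ^ n) - ind"
  by (simp add: bracket_def monom_altdef)

lemma polys_below_iff: "f \<in> polys_below n \<longleftrightarrow> f = 0 \<or> degree f < n"
proof
  assume "f \<in> polys_below n"
  then show "f = 0 \<or> degree f < n"
    by (auto simp: polys_below_def) (metis leading_coeff_0_iff not_le)
qed (auto simp: polys_below_def coeff_eq_0)

lemma polys_below_0 [simp]: "polys_below 0 = {0}"
  by (auto simp: polys_below_iff)

lemma bij_betw_polys_below:
  "bij_betw (\<lambda>(c, b). monom c n + b) (UNIV \<times> polys_below n)
     (polys_below (Suc n) :: 'b :: ab_group_add poly set)"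
proof (rule bij_betwI[where g = "\<lambda>f. (coeff f n, f - monom (coeff f n) n)"])
  show "(\<lambda>f. (coeff f n, f - monom (coeff f n) n)) \<in> polys_below (Suc n) \<rightarrow> UNIV \<times> polys_below n"
    by (auto simp: polys_below_def)
qed (auto simp: polys_below_def)

lemma finite_polys_below [simp]: "finite (polys_below n :: 'b :: {ab_group_add, finite} poly set)"
proof (induction n)
  case (Suc n)
  then have "finite ((UNIV :: 'b set) \<times> (polys_below n :: 'b poly set))" by simp
  then show ?case using bij_betw_finite[OF bij_betw_polys_below] by blast
qed simp

lemma card_polys_below:
  "card (polys_below n :: 'b :: {ab_group_add, finite} poly set) = CARD('b) ^ n"
proof (induction n)
  case (Suc n)
  have "card (polys_below (Suc n) :: 'b poly set) = card ((UNIV :: 'b set) \<times> (polys_below n :: 'b poly set))"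
    using bij_betw_same_card[OF bij_betw_polys_below] by (rule sym)
  then show ?case
    by (simp add: card_cartesian_product Suc)
qed simp

lemma carlitz_L_eq_prod: "carlitz_L n = (\<Prod>i=1..n. bracket i)"
  by (induction n) (simp_all add: prod.nat_ivl_Suc' mult.commute)

text \<open>Cancelling t in the identity between t^q - t and the product of all t + c leaves t^(q-1)
  - 1 as the product over c \<noteq> 0; then t is set to 0.\<close>

lemma prod_nonzero_field: "\<Prod>(UNIV - {0 :: 'a :: {field, finite}}) = - 1"
proof -
  have q: "CARD('a) = Suc (CARD('a) - 1)" "CARD('a) - 1 > 0"
    using one_less_card_field[where ?'a = 'a] by auto
  have "ind * (\<Prod>c\<in>UNIV - {0 :: 'a}. ind + [:c:]) = (\<Prod>c\<in>(UNIV :: 'a set). ind + [:c:])"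
    by (subst prod.remove[where x = 0]) auto
  also have "\<dots> = ind ^ CARD('a) - ind"
    using prod_add_const_mult[of "ind :: 'a poly" 1] by simp
  also have "\<dots> = ind * (ind ^ (CARD('a) - 1) - 1)"
    by (subst q(1)) (simp only: power_Suc right_diff_distrib mult_1_right)
  finally have "(\<Prod>c\<in>UNIV - {0 :: 'a}. ind + [:c:]) = ind ^ (CARD('a) - 1) - 1"
    by simp
  then have "poly (\<Prod>c\<in>UNIV - {0 :: 'a}. ind + [:c:]) 0 = poly (ind ^ (CARD('a) - 1) - 1) 0"
    by (rule arg_cong)
  then show ?thesis
    using q(2) by (simp add: poly_prod poly_power)
qed

lemma prod_nonzero_below_eq:
  "prod_nonzero_below n = \<Prod>(polys_below n - {0 :: 'a :: {field, finite} poly})"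
  unfolding prod_nonzero_below_def
  by (rule prod.cong) (auto simp: polys_below_iff)

text \<open>Translation by 1 permutes the elements, so their sum equals itself plus q times
  1.\<close>

lemma of_nat_card_eq_0: "of_nat CARD('a) = (0 :: 'a :: {ring_1, finite})"
proof -
  have "(\<Sum>x\<in>UNIV. x) = (\<Sum>x\<in>UNIV. x + 1 :: 'a)"
    by (rule sum.reindex_bij_witness[of _ "\<lambda>x. x + 1" "\<lambda>x. x - 1"]) auto
  then show ?thesis by (simp add: sum.distrib)
qed

section \<open>Frobenius identities in A and the product form of D_n\<close>

context
  fixes p e :: nat
  assumes p: "prime p" and card: "CARD('a :: {field, finite}) = p ^ e"
begin

lemma CHAR_eq: "CHAR('a) = p"
proof -
  have "CHAR('a) dvd p ^ e"
    using of_nat_card_eq_0[where ?'a = 'a] card of_nat_eq_0_iff_char_dvd by metis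
  moreover have "prime CHAR('a)"
    by (intro prime_CHAR_semidom finite_imp_CHAR_pos) auto
  ultimately show ?thesis
    using p by (metis prime_dvd_power primes_dvd_imp_eq)
qed

lemma add_power_card:
  "(x + y :: 'a poly) ^ (CARD('a) ^ n) = x ^ (CARD('a) ^ n) + y ^ (CARD('a) ^ n)"
  by (rule freshmans_dream'[where n = "e * n"])
     (use p CHAR_eq in \<open>simp_all add: card power_mult\<close>)

lemma diff_power_card:
  "(x - y :: 'a poly) ^ (CARD('a) ^ n) = x ^ (CARD('a) ^ n) - y ^ (CARD('a) ^ n)"
  using add_power_card[of "x - y" y n] by (simp add: algebra_simps)

lemmas add_power_card1 = add_power_card[where n = 1, simplified]
lemmas diff_power_card1 = diff_power_card[where n = 1, simplified]

lemma const_power_card: "([:c:] :: 'a poly) ^ (CARD('a) ^ n) = [:c:]"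
  by (induction n) (simp_all add: power_mult poly_const_pow finite_field_power_card)

text \<open>Frobenius powers are additive and fix the constants. This is what makes the conjugates
  c_i zeros of P(X) modulo P^q.\<close>

lemma pcompose_power_card:
  "pcompose f (ind ^ (CARD('a) ^ n)) = (f :: 'a poly) ^ (CARD('a) ^ n)"
proof (induction f)
  case (pCons a f)
  have "pCons a f ^ (CARD('a) ^ n) = ([:a:] + ind * f) ^ (CARD('a) ^ n)"
    by simp
  also have "\<dots> = [:a:] + ind ^ (CARD('a) ^ n) * f ^ (CARD('a) ^ n)"
    unfolding add_power_card const_power_card power_mult_distrib ..
  finally show ?case by (simp add: pcompose_pCons pCons.IH)
qed (simp add: zero_power)

lemma bracket_power_card:
  "(bracket n :: 'a poly) ^ (CARD('a) ^ m) = ind ^ (CARD('a) ^ (n + m)) - ind ^ (CARD('a) ^ m)"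
  unfolding bracket_eq diff_power_card by (simp add: power_add flip: power_mult)

text \<open>Raising a factor to the power q shifts both exponents up by one; the new bracket
  supplies the factor for i = 0.\<close>

lemma carlitz_D_eq_prod:
  "carlitz_D n = (\<Prod>i<n. ind ^ (CARD('a) ^ n) - ind ^ (CARD('a) ^ i) :: 'a poly)"
proof (induction n)
  case (Suc n)
  have "(\<Prod>i<n. ind ^ (CARD('a) ^ n) - ind ^ (CARD('a) ^ i) :: 'a poly) ^ CARD('a)
      = (\<Prod>i<n. ind ^ (CARD('a) ^ Suc n) - ind ^ (CARD('a) ^ Suc i))"
    unfolding prod_power_distrib diff_power_card1 power_mult[symmetric]
    by (simp only: power_Suc2)
  then show ?case
    by (simp only: carlitz_D.simps Suc prod.lessThan_Suc_shift bracket_eq) simp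
qed simp

section \<open>The linear polynomials e_n and the product F_n\<close>

lemma carlitz_e_add: "carlitz_e n (x + y) = carlitz_e n x + carlitz_e n (y :: 'a poly)"
  by (induction n) (simp_all add: add_power_card1 algebra_simps)

lemma carlitz_e_const_mult: "carlitz_e n ([:c:] * x) = [:c:] * carlitz_e n (x :: 'a poly)"
proof (induction n)
  case (Suc n)
  have "([:c:] * carlitz_e n x) ^ CARD('a) = [:c:] * carlitz_e n x ^ CARD('a)"
    using const_power_card[of c 1] unfolding power_mult_distrib by simp
  then show ?case
    unfolding carlitz_e.simps Suc by (simp add: smult_diff_right)
qed simp

text \<open>Since e_(n+1) is only F_q-linear, multiplying its argument by t leaves an error term; it
  is this term alone that survives at t^(n+1).\<close>

lemma carlitz_e_ind_mult:
  "carlitz_e (Suc n) (ind * x)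
    = ind * carlitz_e (Suc n) x + bracket (Suc n) * carlitz_e n (x :: 'a poly) ^ CARD('a)"
proof (induction n)
  case 0
  define t :: "'a poly" where "t = ind"
  have "carlitz_e (Suc 0) (t * x) = t * carlitz_e (Suc 0) x + (t ^ CARD('a) - t) * carlitz_e 0 x ^ CARD('a)"
    by (simp add: power_mult_distrib algebra_simps)
  then show ?case by (simp add: t_def bracket_eq)
next
  case (Suc n)
  define q where "q = CARD('a)"
  have q: "q = Suc (q - 1)"
    using one_less_card_field[where ?'a = 'a] by (simp add: q_def)
  define a b B D where "a = carlitz_e (Suc n) x" and "b = carlitz_e n x"
    and "B = (bracket (Suc n) :: 'a poly)" and "D = (carlitz_D n :: 'a poly)"
  define t :: "'a poly" where "t = ind"
  have a: "b ^ q - a = D ^ (q - 1) * b"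
    by (simp add: a_def b_def D_def q_def)
  have B: "B ^ q = t ^ q ^ Suc (Suc n) - t ^ q"
    using bracket_power_card[of "Suc n" 1] by (simp add: B_def q_def t_def)
  have br: "bracket (Suc (Suc n)) = B ^ q + t ^ q - t"
    unfolding B by (simp add: bracket_eq t_def q_def)
  have D: "(B * D ^ q) ^ (q - 1) * B = B ^ q * (D ^ (q - 1)) ^ q"
  proof -
    have "(B * D ^ q) ^ (q - 1) * B = B ^ Suc (q - 1) * (D ^ q) ^ (q - 1)"
      by (simp add: power_mult_distrib)
    also have "(D ^ q) ^ (q - 1) = (D ^ (q - 1)) ^ q"
      by (simp add: mult.commute flip: power_mult)
    finally show ?thesis using q by simp
  qed
  \<comment> \<open>The recursion step, the fact \<open>a\<close>, is raised to the power q and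
    multiplied by B^q, so that \<open>key\<close> removes the iterated power (b^q)^q.\<close>
  have "B ^ q * (b ^ q) ^ q - B ^ q * a ^ q = B ^ q * (b ^ q - a) ^ q"
    unfolding q_def diff_power_card1 right_diff_distrib ..
  also have "\<dots> = (B * D ^ q) ^ (q - 1) * B * b ^ q"
    unfolding a D by (simp add: power_mult_distrib)
  finally have key: "B ^ q * (b ^ q) ^ q = B ^ q * a ^ q + (B * D ^ q) ^ (q - 1) * B * b ^ q"
    by (simp add: algebra_simps)
  have "carlitz_e (Suc (Suc n)) (t * x)
      = (t * a + B * b ^ q) ^ q - (B * D ^ q) ^ (q - 1) * (t * a + B * b ^ q)"
    using Suc unfolding t_def a_def b_def B_def D_def q_def by simp
  also have "(t * a + B * b ^ q) ^ q = t ^ q * a ^ q + B ^ q * (b ^ q) ^ q"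
    using add_power_card1[of "t * a" "B * b ^ q"] by (simp add: q_def power_mult_distrib)
  also have "t ^ q * a ^ q + B ^ q * (b ^ q) ^ q - (B * D ^ q) ^ (q - 1) * (t * a + B * b ^ q)
      = t * (a ^ q - (B * D ^ q) ^ (q - 1) * a) + (B ^ q + t ^ q - t) * a ^ q"
    unfolding key by (simp add: algebra_simps)
  also have "a ^ q - (B * D ^ q) ^ (q - 1) * a = carlitz_e (Suc (Suc n)) x"
    by (simp add: a_def B_def D_def q_def)
  finally show ?case
    unfolding br t_def a_def q_def .
qed

lemma carlitz_e_ind_power: "carlitz_e n (ind ^ n :: 'a poly) = carlitz_D n"
proof (induction n)
  case (Suc n)
  have "carlitz_D n ^ CARD('a) = carlitz_D n ^ (CARD('a) - 1) * (carlitz_D n :: 'a poly)"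
    by (simp add: zero_less_card_finite flip: power_Suc2)
  \<comment> \<open>The two terms of the recursion cancel: t^n, of degree below n + 1, is a zero of
    e_(n+1).\<close>
  then have "carlitz_e (Suc n) (ind ^ n :: 'a poly) = 0"
    by (simp add: Suc)
  then show ?case
    unfolding power_Suc carlitz_e_ind_mult by (simp add: Suc)
qed simp

text \<open>With a = c t^n + b, the product over b is e_n(x) + c D_n by linearity, and the product
  over c is then the recursion step for e_(n+1).\<close>

lemma prod_add_polys_below: "(\<Prod>a\<in>polys_below n. x + a) = carlitz_e n (x :: 'a poly)"
proof (induction n arbitrary: x)
  case (Suc n)
  have "(\<Prod>a\<in>polys_below (Suc n). x + a)
      = (\<Prod>(c, b)\<in>UNIV \<times> polys_below n. x + (monom c n + b))"
    using prod.reindex_bij_betw[OF bij_betw_polys_below, of "\<lambda>a. x + a" n]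
    by (simp add: case_prod_unfold)
  also have "\<dots> = (\<Prod>c\<in>UNIV. \<Prod>b\<in>polys_below n. (x + [:c:] * ind ^ n) + b)"
    by (subst prod.cartesian_product[symmetric]) (simp add: monom_altdef add.assoc)
  also have "\<dots> = (\<Prod>c\<in>UNIV. carlitz_e n x + [:c:] * carlitz_D n)"
    unfolding Suc carlitz_e_add carlitz_e_const_mult carlitz_e_ind_power ..
  also have "\<dots> = carlitz_e (Suc n) x"
    unfolding prod_add_const_mult by simp
  finally show ?case .
qed simp

text \<open>The polynomials with t^n-coefficient c = 0 contribute F_n. For each c \<noteq> 0 the
  product over the lower parts is c D_n, and the q - 1 constants c multiply to -1.\<close>

lemma prod_nonzero_below_Suc:
  "prod_nonzero_below (Suc n) = - prod_nonzero_below n * (carlitz_D n :: 'a poly) ^ (CARD('a) - 1)"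
proof -
  let ?h = "\<lambda>(c, b). monom c n + b :: 'a poly" and ?B = "polys_below n :: 'a poly set"
  have inj: "inj_on ?h (UNIV \<times> ?B)" and img: "?h ` (UNIV \<times> ?B) = polys_below (Suc n)"
    using bij_betw_polys_below[of n, where ?'b = 'a] unfolding bij_betw_def by blast+
  have "(0 :: 'a poly) \<in> ?B" by (simp add: polys_below_def)
  have "?h ` (UNIV \<times> ?B - {(0, 0)}) = ?h ` (UNIV \<times> ?B) - ?h ` {(0, 0)}"
    by (rule inj_on_image_set_diff[OF inj]) (use \<open>0 \<in> ?B\<close> in auto)
  then have bij: "bij_betw ?h (UNIV \<times> ?B - {(0, 0)}) (polys_below (Suc n) - {0})"
    using inj img by (auto simp: bij_betw_def inj_on_diff)
  have split: "UNIV \<times> ?B - {(0, 0)} = {0} \<times> (?B - {0}) \<union> (UNIV - {0}) \<times> ?B"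
    by auto
  have "prod_nonzero_below (Suc n) = (\<Prod>x\<in>UNIV \<times> ?B - {(0, 0)}. ?h x)"
    using prod.reindex_bij_betw[OF bij, of "\<lambda>x. x"] by (simp add: prod_nonzero_below_eq)
  also have "\<dots> = (\<Prod>x\<in>{0} \<times> (?B - {0}). ?h x) * (\<Prod>x\<in>(UNIV - {0}) \<times> ?B. ?h x)"
    unfolding split by (rule prod.union_disjoint) auto
  also have "(\<Prod>x\<in>{0} \<times> (?B - {0}). ?h x) = prod_nonzero_below n"
    unfolding prod_nonzero_below_eq by (subst prod.cartesian_product[symmetric]) simp
  also have "(\<Prod>x\<in>(UNIV - {0}) \<times> ?B. ?h x) = (\<Prod>c\<in>UNIV - {0}. \<Prod>b\<in>?B. [:c:] * ind ^ n + b)"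
    by (subst prod.cartesian_product[symmetric]) (simp add: monom_altdef)
  also have "\<dots> = (\<Prod>c\<in>UNIV - {0}. [:c:] * carlitz_D n)"
    unfolding prod_add_polys_below carlitz_e_const_mult carlitz_e_ind_power ..
  also have "\<dots> = (\<Prod>c\<in>UNIV - {0 :: 'a}. [:c:]) * carlitz_D n ^ (CARD('a) - 1)"
    unfolding prod.distrib by simp
  also have "(\<Prod>c\<in>UNIV - {0 :: 'a}. [:c:]) = - 1"
  proof -
    have "(\<Prod>c\<in>S. [:c:]) = [:\<Prod>S:]" if "finite S" for S :: "'a set"
      using that by induction (simp_all add: one_pCons)
    then show ?thesis by (simp add: prod_nonzero_field one_pCons)
  qed
  finally show ?thesis by simp
qed

lemma prod_nonzero_below_carlitz_L:
  "prod_nonzero_below n * carlitz_L n = (- 1) ^ n * (carlitz_D n :: 'a poly)"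
proof (induction n)
  case 0
  show ?case by (simp add: prod_nonzero_below_eq)
next
  case (Suc n)
  have "prod_nonzero_below (Suc n) * carlitz_L (Suc n)
      = - bracket (Suc n) * carlitz_D n ^ (CARD('a) - 1) * (prod_nonzero_below n * carlitz_L n :: 'a poly)"
    by (simp add: prod_nonzero_below_Suc)
  also have "\<dots> = (- 1) ^ Suc n * bracket (Suc n) * (carlitz_D n ^ (CARD('a) - 1) * carlitz_D n)"
    unfolding Suc by simp
  also have "carlitz_D n ^ (CARD('a) - 1) * carlitz_D n = (carlitz_D n :: 'a poly) ^ CARD('a)"
    by (simp add: zero_less_card_finite flip: power_Suc2)
  finally show ?case by simp
qed

end

subsection \<open>Wilson primes\<close>

lemma prime_elem_not_dvd_prod:
  assumes "prime_elem P" "\<And>i. i \<in> A \<Longrightarrow> \<not> P dvd f i"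
  shows "\<not> P dvd prod f A"
  using assms(2)
proof (induction A rule: infinite_finite_induct)
  case (insert i A)
  then show ?case using prime_elem_dvd_mult_iff[OF assms(1)] by auto
qed (use assms(1) prime_elem_not_unit in auto)

lemma monic_irreducible_prime_elem: "monic_irreducible d P \<Longrightarrow> prime_elem P"
  by (simp add: monic_irreducible_def field_poly_irreducible_imp_prime)

text \<open>If u/v is the fraction in lowest terms, then a v = u b, where P divides at most one of u
  and v, and does not divide b.\<close>

lemma dvd_numerator_Fract_iff:
  fixes P a b :: "'b :: field poly"
  assumes P: "prime_elem P" and b: "\<not> P dvd b"
  shows "P dvd numerator (Fract a b) \<longleftrightarrow> P dvd a"
proof -
  obtain ab where ab: "lowest_terms (Fract a b) (fst ab) (snd ab)"
    and uniq: "\<And>ab'. lowest_terms (Fract a b) (fst ab') (snd ab') \<Longrightarrow> ab' = ab"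
    using lowest_terms_ex1[of "Fract a b"] by blast
  obtain u v where uv: "ab = (u, v)" by (cases ab)
  have "numerator (Fract a b) = u"
    unfolding numerator_def
  proof (rule the_equality)
    show "\<exists>b'. lowest_terms (Fract a b) u b'" using ab uv by auto
    show "x = u" if "\<exists>b'. lowest_terms (Fract a b) x b'" for x
      using that uniq[of "(x, _)"] uv by auto
  qed
  moreover have "Fract a b = Fract u v" and v: "v \<noteq> 0" and "coprime u v"
    using ab uv by (auto simp: lowest_terms_def)
  moreover have "b \<noteq> 0" using b by auto
  ultimately have cross: "a * v = u * b" by (simp add: eq_fract)
  have "P dvd u \<longleftrightarrow> P dvd a"
  proof
    assume "P dvd u"
    then have "\<not> P dvd v"
      using \<open>coprime u v\<close> P by (meson coprime_common_divisor prime_elem_not_unit)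
    moreover have "P dvd a * v" using \<open>P dvd u\<close> by (simp add: cross)
    ultimately show "P dvd a" using P by (simp add: prime_elem_dvd_mult_iff)
  next
    assume "P dvd a"
    then have "P dvd u * b" by (simp flip: cross)
    with b P show "P dvd u" by (simp add: prime_elem_dvd_mult_iff)
  qed
  with \<open>numerator (Fract a b) = u\<close> show ?thesis by simp
qed

lemma sum_inverse_Fract:
  fixes f :: "nat \<Rightarrow> 'b :: field poly"
  assumes "finite A" and "\<And>i. i \<in> A \<Longrightarrow> f i \<noteq> 0"
  shows "(\<Sum>i\<in>A. 1 / Fract (f i) 1) = Fract (\<Sum>i\<in>A. prod f A div f i) (prod f A)"
proof -
  have nz: "prod f A \<noteq> 0" using assms by simp
  have "1 / Fract (f i) 1 = Fract (prod f A div f i) (prod f A)" if "i \<in> A" for i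
  proof -
    have "f i dvd prod f A" using assms(1) that by (rule dvd_prodI)
    then show ?thesis using assms(2)[OF that] nz
      by (simp add: One_fract_def eq_fract)
  qed
  then have "(\<Sum>i\<in>A. 1 / Fract (f i) 1) = (\<Sum>i\<in>A. Fract (prod f A div f i) (prod f A))"
    by simp
  moreover have "(\<Sum>i\<in>B. Fract (g i) b) = Fract (sum g B) b" if "b \<noteq> 0"
    for B :: "nat set" and g and b :: "'b poly"
    using that
    by (induction B rule: infinite_finite_induct) (auto simp: Zero_fract_def eq_fract algebra_simps)
  from this[OF nz] have "(\<Sum>i\<in>A. Fract (prod f A div f i) (prod f A))
      = Fract (\<Sum>i\<in>A. prod f A div f i) (prod f A)" .
  ultimately show ?thesis by simp
qed

lemma diff_dvd_poly_diff:
  fixes f :: "'b :: comm_ring_1 poly"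
  shows "x - y dvd poly f x - poly f y"
proof (induction f)
  case (pCons a f)
  have "poly (pCons a f) x - poly (pCons a f) y = x * (poly f x - poly f y) + (x - y) * poly f y"
    by (simp add: algebra_simps)
  then show ?case using pCons.IH by simp
qed simp

section \<open>The polynomial H and the derivative of L_(d-1)\<close>

text \<open>The polynomial \<open>H\<close> of the introductory comment.\<close>

definition conj_poly :: "nat \<Rightarrow> 'a :: {field, finite} poly poly" where
  "conj_poly d = (\<Prod>i=1..<d. [:ind ^ (CARD('a) ^ i), - 1:])"

lemma poly_conj_poly: "poly (conj_poly d) x = (\<Prod>i=1..<d. ind ^ (CARD('a) ^ i) - x)"
  for x :: "'a :: {field, finite} poly"
  by (simp add: conj_poly_def poly_prod)

lemma carlitz_L_eq_prod': "carlitz_L (d - 1) = (\<Prod>i=1..<d. bracket i)"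
  unfolding carlitz_L_eq_prod by (rule prod.cong) auto

lemma poly_conj_poly_ind: "poly (conj_poly d) ind = carlitz_L (d - 1)"
  unfolding poly_conj_poly carlitz_L_eq_prod' bracket_eq ..

text \<open>For n > 0 the exponent q^n is 0 in F_q, so only -t contributes.\<close>

lemma pderiv_bracket: "0 < n \<Longrightarrow> pderiv (bracket n :: 'a :: {field, finite} poly) = - 1"
  by (simp add: bracket_def pderiv_diff pderiv_monom of_nat_card_eq_0 monom_0 one_pCons zero_power)

lemma bracket_neq_0: "0 < n \<Longrightarrow> bracket n \<noteq> (0 :: 'a :: {field, finite} poly)"
  using pderiv_bracket[of n, where ?'a = 'a] by (metis pderiv_0 neg_equal_0_iff_equal zero_neq_one)

lemma pderiv_carlitz_L:
  "pderiv (carlitz_L (d - 1)) = - (\<Sum>i=1..<d. \<Prod>j\<in>{1..<d} - {i}. bracket j)"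
  unfolding carlitz_L_eq_prod' pderiv_prod sum_negf[symmetric]
  by (rule sum.cong) (simp_all add: pderiv_bracket)

text \<open>Each [i] under d/dt, and each c_i - X under d/dX, has derivative -1, so Leibniz's rule
  gives the same sum on both sides.\<close>

lemma poly_pderiv_conj_poly_ind:
  "poly (pderiv (conj_poly d)) ind = pderiv (carlitz_L (d - 1) :: 'a :: {field, finite} poly)"
  unfolding pderiv_carlitz_L conj_poly_def pderiv_prod sum_negf[symmetric] poly_sum
proof (rule sum.cong)
  fix i :: nat
  have *: "poly [:c, - 1:] x = c - x" for c x :: "'a poly" by simp
  show "poly ((\<Prod>j\<in>{1..<d} - {i}. [:ind ^ (CARD('a) ^ j), - 1:])
        * pderiv [:ind ^ (CARD('a) ^ i), - 1:]) ind
      = - (\<Prod>j\<in>{1..<d} - {i}. bracket j :: 'a poly)"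
    unfolding poly_mult poly_prod * bracket_eq by (simp add: pderiv_pCons)
qed simp

lemma carlitz_L_div_bracket:
  assumes "i \<in> {1..<d}"
  shows "(carlitz_L (d - 1) :: 'a :: {field, finite} poly) div bracket i = (\<Prod>j\<in>{1..<d} - {i}. bracket j)"
proof -
  have "carlitz_L (d - 1) = bracket i * (\<Prod>j\<in>{1..<d} - {i}. bracket j)"
    unfolding carlitz_L_eq_prod' by (rule prod.remove) (use assms in auto)
  moreover have "bracket i \<noteq> (0 :: 'a poly)" using assms by (intro bracket_neq_0) simp
  ultimately show ?thesis by (metis nonzero_mult_div_cancel_left)
qed

section \<open>Brackets, conjugates and congruences modulo powers of P\<close>

context
  fixes p e :: nat
  assumes p: "prime p" and card: "CARD('a :: {field, finite}) = p ^ e"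
begin

lemma of_nat_eq_0_iff_dvd: "of_nat n = (0 :: 'a) \<longleftrightarrow> p dvd n"
  using of_nat_eq_0_iff_char_dvd[where ?'a = 'a] CHAR_eq[OF p card] by simp

context
  fixes P :: "'a poly" and d :: nat
  assumes P: "monic_irreducible d P" and d: "0 < d"
begin

lemma prime_elem_P: "prime_elem P"
  using P by (rule monic_irreducible_prime_elem)

lemma deg_P: "degree P = d" and lead_P: "coeff P d = 1"
  using P by (auto simp: monic_irreducible_def)

lemma not_dvd_low_degree: "f \<noteq> 0 \<Longrightarrow> degree f < d \<Longrightarrow> \<not> P dvd f"
  using dvd_imp_degree_le[of P f] deg_P by auto

text \<open>
  If \<open>P\<close> divided \<open>[i]\<close>, then all \<open>q ^ d\<close> residues modulo \<open>P\<close> would be zeros of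
  \<open>X ^ (q ^ i) - X\<close>.
\<close>

lemma not_dvd_bracket:
  assumes "0 < i" "i < d"
  shows "\<not> P dvd bracket i"
proof
  assume dvd: "P dvd bracket i"
  define q where "q = CARD('a)"
  have q: "1 < q" unfolding q_def by (rule one_less_card_field)
  have qi: "1 < q ^ i" using q assms(1) by (rule one_less_power)
  define f where "f = monom (1 :: 'a poly) (q ^ i) - monom 1 1"
  have "[:P:] dvd f"
  proof (rule const_poly_dvd_of_many_zeros)
    show "finite (polys_below d :: 'a poly set)" by simp
    have "degree f \<le> q ^ i"
      unfolding f_def by (rule degree_diff_le) (use qi in \<open>simp_all add: degree_monom_eq\<close>)
    also have "\<dots> < q ^ d" using q assms by simp
    finally show "degree f < card (polys_below d :: 'a poly set)"
      by (simp add: card_polys_below q_def)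
  next
    fix x :: "'a poly"
    \<comment> \<open>Here x^(q^i) is x(t^(q^i)), which differs from x(t) by a multiple of t^(q^i) -
      t.\<close>
    have "poly f x = pcompose x (ind ^ (q ^ i)) - pcompose x ind"
      using pcompose_power_card[OF p card, of x i] pcompose_power_card[OF p card, of x 0]
      by (simp add: f_def poly_monom q_def)
    then have "bracket i dvd poly f x"
      using diff_dvd_poly_diff[of "ind ^ (q ^ i)" ind "lift_coeffs x"]
      by (simp add: poly_lift_coeffs bracket_eq q_def)
    with dvd show "P dvd poly f x" by (rule dvd_trans)
  next
    fix x y z :: "'a poly"
    assume "x \<in> polys_below d" "y \<in> polys_below d" "x \<noteq> y" "P dvd (x - y) * z"
    moreover from this have "x - y \<in> polys_below d" by (simp add: polys_below_def)
    ultimately show "P dvd z"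
      using not_dvd_low_degree[of "x - y"] prime_elem_dvd_mult_iff[OF prime_elem_P]
      by (auto simp: polys_below_iff)
  qed
  then have "P dvd coeff f (q ^ i)" by (simp add: const_poly_dvd_iff)
  moreover have "coeff f (q ^ i) = 1" using qi by (simp add: f_def)
  ultimately show False using prime_elem_not_unit[OF prime_elem_P] by simp
qed

lemma not_dvd_carlitz_L: "\<not> P dvd carlitz_L (d - 1)"
  unfolding carlitz_L_eq_prod'
  by (rule prime_elem_not_dvd_prod[OF prime_elem_P]) (simp add: not_dvd_bracket)

text \<open>For j < i the difference is a Frobenius power of [i - j], and 0 < i - j < d.\<close>

lemma not_dvd_conj_diff:
  assumes "i \<in> {1..d}" "j \<in> {1..d}" "i \<noteq> j"
  shows "\<not> P dvd ind ^ (CARD('a) ^ i) - ind ^ (CARD('a) ^ j)"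
  using assms
proof (induction j i rule: linorder_wlog)
  case (le j i)
  have "ind ^ (CARD('a) ^ i) - ind ^ (CARD('a) ^ j) = (bracket (i - j) :: 'a poly) ^ (CARD('a) ^ j)"
    unfolding bracket_power_card[OF p card] using le by simp
  moreover have "\<not> P dvd bracket (i - j)"
    using le by (intro not_dvd_bracket) auto
  ultimately show ?case
    using prime_elem_dvd_power[OF prime_elem_P] by metis
next
  case (sym j i)
  then show ?case by (metis dvd_minus_iff minus_diff_eq)
qed

lemma carlitz_D_split:
  "carlitz_D d = bracket d * (\<Prod>i=1..<d. ind ^ (CARD('a) ^ d) - ind ^ (CARD('a) ^ i) :: 'a poly)"
proof -
  have "{..<d} = insert 0 {1..<d}" using d by auto
  then show ?thesis by (simp add: carlitz_D_eq_prod[OF p card] bracket_eq)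
qed

text \<open>
  \<open>P\<close> is one of the factors of \<open>D\<^sub>d\<close>, the product of all monic polynomials of degree \<open>d\<close>,
  and the factors of \<open>D\<^sub>d\<close> other than \<open>[d]\<close> are powers of brackets \<open>[i]\<close> with \<open>0 < i < d\<close>.
\<close>

lemma dvd_bracket: "P dvd bracket d"
proof -
  have "P - ind ^ d \<in> polys_below d"
    unfolding polys_below_def
  proof safe
    fix i assume "d \<le> i"
    then show "coeff (P - ind ^ d) i = 0"
      using deg_P lead_P monom_altdef[of "1 :: 'a" d, symmetric]
      by (cases "i = d") (auto simp: coeff_eq_0)
  qed
  then have "ind ^ d + (P - ind ^ d) dvd (\<Prod>a\<in>polys_below d. ind ^ d + a)"
    by (intro dvd_prodI) auto
  then have "P dvd carlitz_D d"
    by (simp add: prod_add_polys_below[OF p card] carlitz_e_ind_power[OF p card])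
  moreover have "\<not> P dvd (\<Prod>i=1..<d. ind ^ (CARD('a) ^ d) - ind ^ (CARD('a) ^ i))"
    by (rule prime_elem_not_dvd_prod[OF prime_elem_P]) (rule not_dvd_conj_diff, auto)
  ultimately show ?thesis
    unfolding carlitz_D_split using prime_elem_dvd_mult_iff[OF prime_elem_P] by blast
qed

text \<open>A square factor would make P divide the derivative of [d], which is -1.\<close>

lemma not_square_dvd_bracket: "\<not> P\<^sup>2 dvd bracket d"
proof
  assume "P\<^sup>2 dvd bracket d"
  then obtain g where "bracket d = P\<^sup>2 * g" by (rule dvdE)
  then have "pderiv (bracket d) = P * (P * pderiv g + g * pderiv P + g * pderiv P)"
    by (simp add: power2_eq_square pderiv_mult algebra_simps)
  then have "P dvd - 1" using pderiv_bracket[OF d, where ?'a = 'a] by (metis dvd_triv_left)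
  then show False using prime_elem_not_unit[OF prime_elem_P] by simp
qed

text \<open>Both terms have degree d and leading coefficient (-1)^d, so their difference has degree
  below d, while c_1, ..., c_d are d zeros of it modulo P^q whose differences are prime to
  P.\<close>

lemma lift_coeffs_eq_conj_prod:
  "[:P ^ CARD('a):] dvd smult ((- 1) ^ d) (lift_coeffs P) - [:ind ^ (CARD('a) ^ d), - 1:] * conj_poly d"
proof -
  define c where "c = (\<lambda>i. ind ^ (CARD('a) ^ i) :: 'a poly)"
  define G where "G = (\<Prod>i=1..d. [:c i, - 1:])"
  have G: "[:ind ^ (CARD('a) ^ d), - 1:] * conj_poly d = G"
  proof -
    have "{1..d} = insert d {1..<d}" using d by auto
    then show ?thesis by (simp add: G_def conj_poly_def c_def)
  qed
  have degG: "degree G = d"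
    unfolding G_def by (subst degree_prod_eq_sum_degree) auto
  have "lead_coeff G = (\<Prod>i=1..d. - 1)"
    unfolding G_def lead_coeff_prod by (rule prod.cong) auto
  then have lcG: "coeff G d = (- 1) ^ d" by (simp add: degG)
  have c_diff: "\<not> P dvd c i - c j" if "i \<in> {1..d}" "j \<in> {1..d}" "i \<noteq> j" for i j
    unfolding c_def using that by (rule not_dvd_conj_diff)
  have "inj_on c {1..d}"
    using c_diff by (intro inj_onI) (metis diff_self dvd_0_right)
  then have card_c: "card (c ` {1..d}) = d" by (simp add: card_image)
  have "[:P ^ CARD('a):] dvd smult ((- 1) ^ d) (lift_coeffs P) - G"
  proof (rule const_poly_dvd_of_many_zeros)
    show "finite (c ` {1..d})" by simp
    show "degree (smult ((- 1) ^ d) (lift_coeffs P) - G) < card (c ` {1..d})"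
      unfolding card_c
    proof (rule degree_lessI)
      show "\<forall>k\<ge>d. coeff (smult ((- 1) ^ d) (lift_coeffs P) - G) k = 0"
        using degG lcG deg_P lead_P by (auto simp: le_less coeff_eq_0 simp flip: one_pCons)
    qed (use d in simp)
  next
    fix x assume "x \<in> c ` {1..d}"
    then obtain i where i: "i \<in> {1..d}" and x: "x = c i" by blast
    have "poly G x = 0"
      unfolding G_def poly_prod by (rule prod_zero) (use i x in auto)
    moreover have "poly (lift_coeffs P) x = P ^ (CARD('a) ^ i)"
      unfolding x c_def poly_lift_coeffs by (rule pcompose_power_card[OF p card])
    \<comment> \<open>As i \<ge> 1, the value P(c_i) = P^(q^i) is divisible by P^q; c_0 = t would
      give only P.\<close>
    moreover have "CARD('a) ^ 1 \<le> CARD('a) ^ i"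
      using i one_less_card_field[where ?'a = 'a] by (intro power_increasing) auto
    then have "P ^ CARD('a) dvd P ^ (CARD('a) ^ i)"
      by (simp add: le_imp_power_dvd)
    ultimately show "P ^ CARD('a) dvd poly (smult ((- 1) ^ d) (lift_coeffs P) - G) x"
      by simp
  next
    fix x y z assume xy: "x \<in> c ` {1..d}" "y \<in> c ` {1..d}" "x \<noteq> y"
      and dvd: "P ^ CARD('a) dvd (x - y) * z"
    from xy have "\<not> P dvd x - y" using c_diff by (metis imageE)
    then show "P ^ CARD('a) dvd z"
      using dvd by (rule prime_elem_power_dvd_cancel[OF prime_elem_P])
  qed
  then show ?thesis unfolding G .
qed

text \<open>The congruence for P(X) is differentiated k + 1 times in X and evaluated at X = t, where
  the factor c_d - X takes the value [d] and has derivative -1.\<close>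

lemma higher_pderiv_cong:
  "P ^ CARD('a) dvd (- 1) ^ d * (pderiv ^^ Suc k) P
     - (bracket d * poly ((pderiv ^^ Suc k) (conj_poly d)) ind
        - of_nat (Suc k) * poly ((pderiv ^^ k) (conj_poly d)) ind)"
proof -
  let ?R = "smult ((- 1) ^ d) (lift_coeffs P) - [:ind ^ (CARD('a) ^ d), - 1:] * conj_poly d"
  have diff: "(pderiv ^^ n) (f - g) = (pderiv ^^ n) f - (pderiv ^^ n) g" for n and f g :: "'a poly poly"
    by (induction n arbitrary: f g) (simp_all add: pderiv_diff funpow_swap1)
  have ind: "pcompose f ind = f" for f :: "'a poly"
    using pcompose_power_card[OF p card, of f 0] by simp
  have "poly ((pderiv ^^ Suc k) ?R) ind = (- 1) ^ d * (pderiv ^^ Suc k) P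
     - (bracket d * poly ((pderiv ^^ Suc k) (conj_poly d)) ind
        - of_nat (Suc k) * poly ((pderiv ^^ k) (conj_poly d)) ind)"
    unfolding diff higher_pderiv_linear_mult higher_pderiv_smult higher_pderiv_lift_coeffs
    by (simp add: poly_lift_coeffs ind bracket_eq algebra_simps del: funpow.simps of_nat_Suc)
  then show ?thesis
    using const_poly_dvd_higher_pderiv[OF lift_coeffs_eq_conj_prod, of "Suc k" ind] by simp
qed

text \<open>With L = L_(d-1) and F = F_d, Taylor expansion of FL = -H(t + [d]) makes (F + 1) L and
  -[d] L' congruent modulo P^2. Moreover P does not divide L and divides [d] exactly once.\<close>

lemma wilson_prime_iff_dvd_pderiv_carlitz_L:
  "wilson_prime d P \<longleftrightarrow> P dvd pderiv (carlitz_L (d - 1))"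
proof -
  define L where "L = (carlitz_L (d - 1) :: 'a poly)"
  define F where "F = (prod_nonzero_below d :: 'a poly)"
  define B where "B = (bracket d :: 'a poly)"
  have carlitz_L_d: "carlitz_L d = B * L"
    using d unfolding B_def L_def by (cases d) simp_all
  have "B * (F * L) = (- 1) ^ d * carlitz_D d"
    using prod_nonzero_below_carlitz_L[OF p card, of d]
    unfolding carlitz_L_d F_def by (simp add: mult_ac)
  \<comment> \<open>The factors c_d - c_i are turned round so that their product becomes H(c_d) up
    to the sign of d - 1 factors; c_d is t + [d].\<close>
  also have "\<dots> = B * ((- 1) ^ d * (\<Prod>i=1..<d. - (ind ^ (CARD('a) ^ i) - ind ^ (CARD('a) ^ d))))"
    unfolding carlitz_D_split B_def by simp
  also have "(\<Prod>i=1..<d. - (ind ^ (CARD('a) ^ i) - ind ^ (CARD('a) ^ d) :: 'a poly))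
      = (- 1) ^ (d - 1) * poly (conj_poly d) (ind ^ (CARD('a) ^ d))"
    unfolding prod_uminus poly_conj_poly by simp
  also have "(- 1) ^ d * ((- 1) ^ (d - 1) * poly (conj_poly d) (ind ^ (CARD('a) ^ d) :: 'a poly))
      = - poly (conj_poly d) (ind + B)"
    using d by (cases d) (simp_all add: B_def bracket_eq)
  finally have FL: "F * L = - poly (conj_poly d) (ind + B)"
    using bracket_neq_0[OF d, where ?'a = 'a] by (metis B_def mult_left_cancel)
  have "B\<^sup>2 dvd poly (conj_poly d) (ind + B) - L - B * pderiv L"
    using taylor_dvd[of B "conj_poly d" ind]
    unfolding poly_conj_poly_ind poly_pderiv_conj_poly_ind L_def .
  moreover have "P\<^sup>2 dvd B\<^sup>2"
    using dvd_bracket unfolding B_def by (rule dvd_power_same)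
  ultimately have "P\<^sup>2 dvd poly (conj_poly d) (ind + B) - L - B * pderiv L"
    by (metis dvd_trans)
  then have "P\<^sup>2 dvd - ((F + 1) * L + B * pderiv L)"
    using FL by (simp add: algebra_simps)
  then have "P\<^sup>2 dvd (F + 1) * L + B * pderiv L"
    by (simp only: dvd_minus_iff)
  then have cong: "P\<^sup>2 dvd (F + 1) * L \<longleftrightarrow> P\<^sup>2 dvd B * pderiv L"
    by (metis dvd_add_right_iff dvd_add_left_iff)
  have "wilson_prime d P \<longleftrightarrow> P\<^sup>2 dvd F + 1"
    using P by (simp add: wilson_prime_def F_def cong_iff_dvd_diff)
  also have "\<dots> \<longleftrightarrow> P\<^sup>2 dvd (F + 1) * L"
    using prime_elem_power_dvd_cancel[OF prime_elem_P not_dvd_carlitz_L, of 2 "F + 1"]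
    by (auto simp: L_def mult.commute)
  also have "\<dots> \<longleftrightarrow> P dvd pderiv L"
    unfolding cong
  proof
    assume "P\<^sup>2 dvd B * pderiv L"
    then show "P dvd pderiv L"
      using prime_elem_power_dvd_cases[of P 2 B "pderiv L" 2 1] prime_elem_P not_square_dvd_bracket
      by (auto simp: B_def)
  next
    assume "P dvd pderiv L"
    then show "P\<^sup>2 dvd B * pderiv L"
      unfolding power2_eq_square B_def using dvd_bracket by (intro mult_dvd_mono)
  qed
  finally show ?thesis by (simp add: L_def)
qed

section \<open>From L_(d-1)' to P'', multiplicities and degrees\<close>

lemma dvd_of_nat_mult_cancel:
  assumes "\<not> p dvd n" "f dvd of_nat n * (g :: 'a poly)"
  shows "f dvd g"
  using assms of_nat_eq_0_iff_dvd[of n] by (simp add: of_nat_poly dvd_smult_iff)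

text \<open>Modulo P, where [d] vanishes, the case k = 1 of \<open>higher_pderiv_cong\<close>
  relates P'' to -2 L_(d-1)' up to sign, and 2 is invertible as p is odd.\<close>

lemma dvd_pderiv_carlitz_L_iff:
  assumes "odd p"
  shows "P dvd pderiv (carlitz_L (d - 1)) \<longleftrightarrow> pderiv (pderiv P) = 0"
proof -
  let ?L' = "pderiv (carlitz_L (d - 1)) :: 'a poly"
  let ?H'' = "poly (pderiv (pderiv (conj_poly d))) ind :: 'a poly"
  have "P dvd P ^ CARD('a)" by (simp add: dvd_power zero_less_card_finite)
  then have "P dvd (- 1) ^ d * pderiv (pderiv P) - (bracket d * ?H'' - of_nat 2 * ?L')"
    using dvd_trans[OF _ higher_pderiv_cong[of 1]]
    by (simp add: poly_pderiv_conj_poly_ind numeral_2_eq_2)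
  moreover have "P dvd bracket d * ?H''" using dvd_bracket by simp
  ultimately have "P dvd ((- 1) ^ d * pderiv (pderiv P) - (bracket d * ?H'' - of_nat 2 * ?L'))
      + bracket d * ?H''"
    by (rule dvd_add)
  then have "P dvd (- 1) ^ d * pderiv (pderiv P) + of_nat 2 * ?L'"
    by (simp only: diff_diff_eq2 diff_add_cancel)
  then have "P dvd of_nat 2 * ?L' \<longleftrightarrow> P dvd (- 1) ^ d * pderiv (pderiv P)"
    using dvd_add_right_iff dvd_add_left_iff by metis
  moreover have "P dvd of_nat 2 * ?L' \<longleftrightarrow> P dvd ?L'"
  proof -
    have "\<not> p dvd 2" using assms p by (metis dvd_refl primes_dvd_imp_eq two_is_prime_nat)
    then show ?thesis using dvd_of_nat_mult_cancel by (metis dvd_mult)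
  qed
  moreover have "P dvd (- 1) ^ d * pderiv (pderiv P) \<longleftrightarrow> P dvd pderiv (pderiv P)"
    by (cases "even d") auto
  \<comment> \<open>The degree of P'' is below d, so P divides it only if it is 0.\<close>
  moreover have "P dvd pderiv (pderiv P) \<longleftrightarrow> pderiv (pderiv P) = 0"
  proof -
    have "degree (pderiv (pderiv P)) \<le> d - 1"
    proof (rule degree_le, safe)
      fix i assume "d - 1 < i"
      then show "coeff (pderiv (pderiv P)) i = 0"
        using deg_P by (simp add: coeff_pderiv coeff_eq_0)
    qed
    then show ?thesis using not_dvd_low_degree[of "pderiv (pderiv P)"] d
      by (metis Suc_pred' dvd_0_right le_imp_less_Suc)
  qed
  ultimately show ?thesis by simp
qed

text \<open>Induction on j lowers the order k = p - 1 - j of the derivative. Since derivatives of P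
  of order at least 2 vanish, k + 1 times the k-th derivative of H at t is congruent to [d] times
  the next one, and [d] brings one more factor P. As k + 1 < p in each step, k + 1 can be
  cancelled.\<close>

lemma power_dvd_higher_pderiv_conj_poly:
  assumes "pderiv (pderiv P) = 0" "j \<le> p - 2"
  shows "P ^ j dvd poly ((pderiv ^^ (p - 1 - j)) (conj_poly d)) ind"
  using assms(2)
proof (induction j)
  case (Suc j)
  define k where "k = p - 1 - Suc j"
  have k: "p - 1 - j = Suc k" "0 < k" "Suc k < p"
    using Suc.prems by (auto simp: k_def)
  let ?h = "\<lambda>n. poly ((pderiv ^^ n) (conj_poly d)) ind :: 'a poly"
  have "(pderiv ^^ Suc k) P = (pderiv ^^ (k - 1)) (pderiv (pderiv P))"
    using k(2) by (cases k) (simp_all add: funpow_swap1)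
  then have zero: "(pderiv ^^ Suc k) P = 0" using assms(1) by simp
  \<comment> \<open>The congruence is only known modulo P^q; the exponent stays in range as j + 1 <
    p \<le> q.\<close>
  have "Suc j \<le> CARD('a)"
  proof -
    have "e \<noteq> 0" using card one_less_card_field[where ?'a = 'a] by (intro notI) simp
    then have "p ^ 1 \<le> p ^ e" using p by (intro power_increasing) (auto simp: Suc_leI prime_gt_0_nat)
    then show ?thesis using Suc.prems card by simp
  qed
  then have "P ^ Suc j dvd P ^ CARD('a)" by (rule le_imp_power_dvd)
  then have "P ^ Suc j dvd 0 - (bracket d * ?h (Suc k) - of_nat (Suc k) * ?h k)"
    using higher_pderiv_cong[of k] unfolding zero mult_zero_right by (rule dvd_trans)
  then have "P ^ Suc j dvd of_nat (Suc k) * ?h k - bracket d * ?h (Suc k)"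
    by simp
  moreover have "P ^ Suc j dvd bracket d * ?h (Suc k)"
    using Suc.IH Suc.prems dvd_bracket k(1) unfolding power_Suc by (intro mult_dvd_mono) auto
  ultimately have "P ^ Suc j dvd of_nat (Suc k) * ?h k"
    by (metis dvd_diff_left_iff)
  moreover have "\<not> p dvd Suc k" using k(3) by (simp add: nat_dvd_not_less)
  ultimately show ?case
    unfolding k_def[symmetric] using dvd_of_nat_mult_cancel by blast
qed simp

lemma power_dvd_pderiv_carlitz_L:
  assumes "pderiv (pderiv P) = 0"
  shows "P ^ (p - 2) dvd pderiv (carlitz_L (d - 1))"
proof -
  \<comment> \<open>At j = p - 2 the order is 1, and H'(t) is L_(d-1)'.\<close>
  have "p - 1 - (p - 2) = 1" using prime_ge_2_nat[OF p] by simp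
  then show ?thesis
    using power_dvd_higher_pderiv_conj_poly[OF assms order_refl]
    by (simp add: poly_pderiv_conj_poly_ind)
qed

text \<open>The leading term t^d of P gives P'' the coefficient d (d - 1) at t^(d-2), which must
  vanish in F_q.\<close>

lemma dvd_degree_or_dvd_degree_minus_1:
  assumes "pderiv (pderiv P) = 0"
  shows "p dvd d \<or> p dvd (d - 1)"
\<comment> \<open>For d = 1 there is no such coefficient, but p divides d - 1 = 0.\<close>
proof (cases "d = 1")
  case False
  then obtain m where m: "d = Suc (Suc m)" using d by (metis One_nat_def not_gr_zero nat.exhaust)
  have "coeff (pderiv (pderiv P)) m = of_nat (Suc m * Suc (Suc m))"
    using lead_P[unfolded m] unfolding coeff_pderiv by (simp add: algebra_simps)
  then have "p dvd Suc m * Suc (Suc m)"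
    using assms of_nat_eq_0_iff_dvd[of "Suc m * Suc (Suc m)"] by (metis coeff_0)
  then have "p dvd Suc m \<or> p dvd Suc (Suc m)"
    using p by (simp only: prime_dvd_mult_iff)
  then show ?thesis by (auto simp: m)
qed simp

text \<open>The common denominator L_(d-1) is prime to P, and over it the sum has numerator
  -L_(d-1)'.\<close>

lemma dvd_numerator_iff:
  "P dvd numerator (\<Sum>i=1..<d. 1 / Fract (bracket i) 1) \<longleftrightarrow> P dvd pderiv (carlitz_L (d - 1))"
proof -
  have "(\<Sum>i=1..<d. 1 / Fract (bracket i) 1)
      = Fract (\<Sum>i=1..<d. carlitz_L (d - 1) div bracket i) (carlitz_L (d - 1) :: 'a poly)"
    unfolding carlitz_L_eq_prod' by (rule sum_inverse_Fract) (simp_all add: bracket_neq_0)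
  then have "P dvd numerator (\<Sum>i=1..<d. 1 / Fract (bracket i) 1)
      \<longleftrightarrow> P dvd (\<Sum>i=1..<d. carlitz_L (d - 1) div bracket i)"
    by (simp only: dvd_numerator_Fract_iff[OF prime_elem_P not_dvd_carlitz_L])
  also have "(\<Sum>i=1..<d. carlitz_L (d - 1) div bracket i) = - pderiv (carlitz_L (d - 1) :: 'a poly)"
    unfolding pderiv_carlitz_L minus_minus by (rule sum.cong) (simp_all only: carlitz_L_div_bracket)
  finally show ?thesis by simp
qed

end

end

theorem theorem5:
  fixes p e d :: nat
  assumes "prime p" and "odd p" and "e > 0" and "CARD('a :: {field, finite}) = p ^ e"
    and "d > 0"
  shows
    "{P :: 'a poly. monic_irreducible d P \<and>
        P dvd numerator (\<Sum>i = 1..d - 1. 1 / Fract (bracket i) 1)} = {P. wilson_prime d P}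
     \<and> {P :: 'a poly. monic_irreducible d P \<and> P dvd - pderiv (carlitz_L (d - 1))}
        = {P. wilson_prime d P}
     \<and> - pderiv (carlitz_L (d - 1)) =
        (\<Sum>i = 1..d - 1. (carlitz_L (d - 1) :: 'a poly) div bracket i)
     \<and> {P :: 'a poly. wilson_prime d P} =
        {P. monic_irreducible d P \<and> pderiv (pderiv P) = 0}
     \<and> ((\<exists>P :: 'a poly. wilson_prime d P) \<longrightarrow> p dvd d \<or> p dvd (d - 1))
     \<and> (\<forall>P :: 'a poly. wilson_prime d P \<longrightarrow>
          enat (p - 2) \<le> prime_mult P (pderiv (carlitz_L (d - 1))))"
proof -
  note p = assms(1) and card = assms(4) and d = assms(5)
  have ivl: "{1..d - 1} = {1..<d}" using d by auto
  have monic: "monic_irreducible d P" if "wilson_prime d P" for P :: "'a poly"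
    using that by (simp add: wilson_prime_def)
  \<comment> \<open>All the conditions are compared with P dividing L_(d-1)'.\<close>
  have iff: "wilson_prime d P \<longleftrightarrow> P dvd pderiv (carlitz_L (d - 1))"
      "P dvd numerator (\<Sum>i = 1..d - 1. 1 / Fract (bracket i) 1) \<longleftrightarrow> P dvd pderiv (carlitz_L (d - 1))"
      "pderiv (pderiv P) = 0 \<longleftrightarrow> P dvd pderiv (carlitz_L (d - 1))"
    if "monic_irreducible d P" for P :: "'a poly"
    using that wilson_prime_iff_dvd_pderiv_carlitz_L[OF p card _ d]
      dvd_numerator_iff[OF p card _ d] dvd_pderiv_carlitz_L_iff[OF p card _ d assms(2)]
    unfolding ivl by blast+
  have "- pderiv (carlitz_L (d - 1)) = (\<Sum>i = 1..d - 1. (carlitz_L (d - 1) :: 'a poly) div bracket i)"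
    unfolding ivl pderiv_carlitz_L minus_minus by (rule sum.cong) (simp_all only: carlitz_L_div_bracket)
  moreover have "p dvd d \<or> p dvd (d - 1)" if "wilson_prime d P" for P :: "'a poly"
    using that monic iff dvd_degree_or_dvd_degree_minus_1[OF p card _ d] by blast
  \<comment> \<open>The exponent p - 2 lies in the set whose supremum is the multiplicity; this
    includes the case L_(d-1)' = 0, as for d = 1.\<close>
  moreover have "enat (p - 2) \<le> prime_mult P (pderiv (carlitz_L (d - 1)))"
    if "wilson_prime d P" for P :: "'a poly"
    unfolding prime_mult_def
    using that monic iff power_dvd_pderiv_carlitz_L[OF p card _ d] by (intro SUP_upper) blast
  moreover have "{P :: 'a poly. monic_irreducible d P \<and>
        P dvd numerator (\<Sum>i = 1..d - 1. 1 / Fract (bracket i) 1)} = {P. wilson_prime d P}"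
    using monic iff(1,2) by blast
  moreover have "{P :: 'a poly. monic_irreducible d P \<and> P dvd - pderiv (carlitz_L (d - 1))}
      = {P. wilson_prime d P}"
    unfolding dvd_minus_iff using monic iff(1) by blast
  moreover have "{P :: 'a poly. wilson_prime d P} = {P. monic_irreducible d P \<and> pderiv (pderiv P) = 0}"
    using monic iff(1,3) by blast
  ultimately show ?thesis
    by (intro conjI) (simp_all only:, auto)
qed

end
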